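(* Let $t=2^s$ for some integer $s\geq 2$. Then $$\mathrm{ex}^*(n,B_{t,3})=\frac{t}{2}n+O(1).$$
   Context: All graphs are finite and simple. An edge-coloring of a graph is a function $c:E(G)\to\mathbb{N}$; it is proper if incident edges receive different colors. A subgraph is rainbow under $c$ if its edges have pairwise distinct colors. A graph $G$ is rainbow-$F$-free if it admits a proper edge-coloring under which no (not necessarily induced) copy of $F$ in $G$ is rainbow. The rainbow Turán number $\mathrm{ex}^*(n,F)$ is the maximum number of edges in an $n$-vertex rainbow-$F$-free graph. For $t\ge 3$, $B_{t,3}$ is the broom with $t$ edges and handle length $3$: the tree obtained from a path with $3$ edges (the handle) by adding $t-3$ pendant edges (the bristles) at one end vertex of the path. Here $O(1)$ is a quantity bounded by a constant depending only on $t$, as $n\to\infty$. *)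

theory Defs
  imports Complex_Main "HOL-Library.Landau_Symbols"
begin

type_synonym 'a graph = "'a set \<times> 'a set set"

abbreviation verts :: "'a graph \<Rightarrow> 'a set" where
  "verts G \<equiv> fst G"

abbreviation edges :: "'a graph \<Rightarrow> 'a set set" where
  "edges G \<equiv> snd G"

definition fin_simple_graph :: "'a graph \<Rightarrow> bool" where
  "fin_simple_graph G \<longleftrightarrow>
     finite (verts G) \<and> (\<forall>e\<in>edges G. e \<subseteq> verts G \<and> card e = 2)"

definition is_subgraph :: "'a graph \<Rightarrow> 'a graph \<Rightarrow> bool" where
  "is_subgraph H G \<longleftrightarrow>
     fin_simple_graph H \<and> verts H \<subseteq> verts G \<and> edges H \<subseteq> edges G"

definition isomorphic :: "'a graph \<Rightarrow> 'b graph \<Rightarrow> bool" where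
  "isomorphic F H \<longleftrightarrow>
     (\<exists>f. bij_betw f (verts F) (verts H) \<and>
          (\<forall>u\<in>verts F. \<forall>v\<in>verts F. {u, v} \<in> edges F \<longleftrightarrow> {f u, f v} \<in> edges H))"

text \<open>Colorings are total functions on vertex sets; only their values on edges matter.\<close>

definition proper_edge_coloring :: "'a graph \<Rightarrow> ('a set \<Rightarrow> nat) \<Rightarrow> bool" where
  "proper_edge_coloring G c \<longleftrightarrow>
     (\<forall>e\<in>edges G. \<forall>e'\<in>edges G. e \<noteq> e' \<and> e \<inter> e' \<noteq> {} \<longrightarrow> c e \<noteq> c e')"

definition rainbow :: "('a set \<Rightarrow> nat) \<Rightarrow> 'a graph \<Rightarrow> bool" where
  "rainbow c H \<longleftrightarrow> inj_on c (edges H)"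

definition rainbow_free :: "'b graph \<Rightarrow> 'a graph \<Rightarrow> bool" where
  "rainbow_free F G \<longleftrightarrow>
     (\<exists>c. proper_edge_coloring G c \<and>
          (\<forall>H. is_subgraph H G \<and> isomorphic F H \<longrightarrow> \<not> rainbow c H))"

text \<open>Every finite graph is isomorphic to one whose vertices are natural numbers, so
  restricting the vertex type loses no generality.\<close>

definition rainbow_turan :: "nat \<Rightarrow> 'b graph \<Rightarrow> nat" where
  "rainbow_turan n F =
     Max {card (edges G) | G :: nat graph.
            fin_simple_graph G \<and> card (verts G) = n \<and> rainbow_free F G}"

text \<open>The broom with \<open>t\<close> edges and handle length \<open>l\<close> (meaningful for \<open>1 \<le> l \<le> t\<close>):
  the handle is the path \<open>0, 1, \<dots>, l\<close>, and the bristles join its end vertex \<open>l\<close> to the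
  \<open>t - l\<close> further vertices \<open>l + 1, \<dots>, t\<close>.\<close>

definition broom :: "nat \<Rightarrow> nat \<Rightarrow> nat graph" where
  "broom t l = ({0..t}, {{i, i + 1} | i. i < l} \<union> {{l, j} | j. j \<in> {l + 1..t}})"

text \<open>The set over which \<^const>\<open>rainbow_turan\<close> takes the maximum is finite, and it is
  nonempty whenever \<open>F\<close> is a simple graph with an edge, so the maximum is attained.\<close>

lemma finite_rainbow_turan_set:
  "finite {card (edges G) | G :: nat graph.
            fin_simple_graph G \<and> card (verts G) = n \<and> rainbow_free F G}"
proof (rule finite_subset)
  show "{card (edges G) | G :: nat graph.
            fin_simple_graph G \<and> card (verts G) = n \<and> rainbow_free F G} \<subseteq> {..2 ^ n}"
  proof -
    have "card (edges G) \<le> 2 ^ card (verts G)" if "fin_simple_graph G" for G :: "nat graph"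
    proof -
      have "edges G \<subseteq> Pow (verts G)" "finite (verts G)"
        using that by (auto simp: fin_simple_graph_def)
      then show ?thesis
        by (metis card_Pow card_mono finite_Pow_iff)
    qed
    then show ?thesis by auto
  qed
qed simp

lemma rainbow_turan_set_nonempty:
  assumes "fin_simple_graph F" "edges F \<noteq> {}"
  shows "{card (edges G) | G :: nat graph.
            fin_simple_graph G \<and> card (verts G) = n \<and> rainbow_free F G} \<noteq> {}"
proof -
  let ?G = "({..<n}, {}) :: nat graph"
  obtain e where e: "e \<in> edges F" using assms(2) by blast
  then have "card e = 2" "e \<subseteq> verts F" using assms(1) by (auto simp: fin_simple_graph_def)
  then obtain u v where uv: "e = {u, v}" by (auto simp: card_2_iff)
  have "\<not> isomorphic F H" if "is_subgraph H ?G" for H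
    using that e uv \<open>e \<subseteq> verts F\<close> by (auto simp: is_subgraph_def isomorphic_def)
  then have "rainbow_free F ?G"
    by (auto simp: rainbow_free_def proper_edge_coloring_def)
  moreover have "fin_simple_graph ?G" "card (verts ?G) = n"
    by (auto simp: fin_simple_graph_def)
  ultimately show ?thesis by blast
qed

lemma fin_simple_graph_broom:
  assumes "l \<le> t"
  shows "fin_simple_graph (broom t l)"
  using assms by (auto simp: fin_simple_graph_def broom_def)

lemma card_edges_broom:
  assumes "l \<le> t"
  shows "card (edges (broom t l)) = t"
proof -
  let ?P = "(\<lambda>i. {i, i + 1}) ` {..<l}" and ?Q = "(\<lambda>j. {l, j}) ` {l + 1..t}"
  have "edges (broom t l) = ?P \<union> ?Q"
    by (auto simp: broom_def)
  moreover have "?P \<inter> ?Q = {}"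
    by (auto simp: doubleton_eq_iff)
  moreover have "card ?P = l"
    by (subst card_image) (auto simp: inj_on_def doubleton_eq_iff)
  moreover have "card ?Q = t - l"
    by (subst card_image) (auto simp: inj_on_def doubleton_eq_iff)
  ultimately show ?thesis
    using assms by (simp add: card_Un_disjoint)
qed

end

theory Submission imports Defs begin

text \<open>Lower bound: disjoint copies of \<open>K\<^bsub>t,t\<^esub>\<close>, realised as the Cayley graph on bit strings whose
  generators form a coset \<open>S\<close> with \<open>t\<close> elements of a subgroup, coloured by the generators. A rainbow
  broom would use every colour, but the sum of its three handle colours again lies in \<open>S\<close>, which
  forces a bristle to end at the far end of the handle.

  Upper bound: \<open>2|E| \<le> t|V|\<close> holds whenever 4 divides \<open>t \<ge> 4\<close>. In a minimal counterexample a vertex of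
  degree at least \<open>t + 1\<close> must be adjacent to all others and have degree exactly \<open>t + 1\<close>, so
  \<open>|V| = t + 2\<close>. Label \<open>x\<close> by the colour of \<open>ux\<close>, writing \<open>L u\<close> for this bijection. At a vertex \<open>u\<close>
  adjacent to all others, the absence of a rainbow broom makes \<open>(L u)\<^sup>-\<^sup>1 \<circ> L a\<close> an involution, also if
  \<open>a\<close> misses one neighbour. Counting yields vertices \<open>u\<close>, \<open>v\<close> missing none and \<open>a\<close> missing at most one.
  The three resulting fixed-point-free involutions generate a Klein four-group acting freely on \<open>V\<close>,
  so 4 divides \<open>t + 2\<close>, a contradiction.\<close>

section \<open>Free actions by involutions\<close>

text \<open>The orbits \<open>{x, p x}\<close> partition \<open>A\<close> into pairs.\<close>

lemma even_card_if_involution: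
  assumes "finite A" "\<And>x. x \<in> A \<Longrightarrow> p x \<in> A" "\<And>x. x \<in> A \<Longrightarrow> p (p x) = x"
    "\<And>x. x \<in> A \<Longrightarrow> p x \<noteq> x"
  shows "even (card A)"
proof -
  let ?C = "(\<lambda>x. {x, p x}) ` A"
  have U: "\<Union>?C = A" using assms(2) by auto
  have "2 dvd card (\<Union>?C)"
  proof (rule dvd_partition)
    show "finite (\<Union>?C)" using U assms(1) by simp
    show "\<forall>X\<in>?C. 2 dvd card X" using assms(4) by (auto simp: card_insert_if) (metis assms(4))
    show "\<forall>X\<in>?C. \<forall>Y\<in>?C. X \<noteq> Y \<longrightarrow> X \<inter> Y = {}"
    proof (intro ballI impI)
      fix X Y assume "X \<in> ?C" "Y \<in> ?C" "X \<noteq> Y"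
      then obtain x y where xy: "x \<in> A" "y \<in> A" "X = {x, p x}" "Y = {y, p y}"
        by (elim imageE)
      have "X = Y" if "z \<in> X" "z \<in> Y" for z
      proof -
        have "{w, p w} = {z, p z}" if "w \<in> A" "z \<in> {w, p w}" for w
          using that(2) by (elim insertE emptyE) (simp_all add: assms(3)[OF that(1)] insert_commute)
        from this[OF xy(1)] this[OF xy(2)] show "X = Y" using that unfolding xy(3,4) by blast
      qed
      then show "X \<inter> Y = {}" using \<open>X \<noteq> Y\<close> by blast
    qed
  qed
  then show ?thesis using U by simp
qed

text \<open>The orbits \<open>{x, p x, q x, p (q x)}\<close> partition \<open>A\<close>. Each has
  exactly four elements: \<open>p (q x) = x\<close> would give \<open>p x = q x\<close>, and every
  other coincidence is a fixed point of \<open>p\<close> or \<open>q\<close>.\<close>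

lemma four_dvd_card_if_free_klein_action:
  assumes "finite A" and pA: "\<And>x. x \<in> A \<Longrightarrow> p x \<in> A" and qA: "\<And>x. x \<in> A \<Longrightarrow> q x \<in> A"
    and pp: "\<And>x. x \<in> A \<Longrightarrow> p (p x) = x" and qq: "\<And>x. x \<in> A \<Longrightarrow> q (q x) = x"
    and pq: "\<And>x. x \<in> A \<Longrightarrow> p (q x) = q (p x)"
    and ne: "\<And>x. x \<in> A \<Longrightarrow> p x \<noteq> x" "\<And>x. x \<in> A \<Longrightarrow> q x \<noteq> x" "\<And>x. x \<in> A \<Longrightarrow> p x \<noteq> q x"
  shows "4 dvd card A"
proof -
  let ?O = "\<lambda>x. {x, p x, q x, p (q x)}"
  have U: "\<Union>(?O ` A) = A" using pA qA by auto
  have sub: "?O y \<subseteq> ?O x" if "x \<in> A" "y \<in> ?O x" for x y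
  proof -
    have cl: "p x \<in> A" "q x \<in> A" "p (q x) \<in> A" using that(1) pA qA by simp_all
    have e: "p (p x) = x" "q (q x) = x" "q (p x) = p (q x)" "p (p (q x)) = q x" "q (p (q x)) = p x"
      "p (q (p x)) = q x" "p (q (q x)) = p x" "p (q (p (q x))) = x"
      using that(1) cl pp qq pq by simp_all
    show ?thesis using that(2) by (elim insertE emptyE) (simp_all add: e insert_commute)
  qed
  have "4 dvd card (\<Union>(?O ` A))"
  proof (rule dvd_partition)
    show "finite (\<Union>(?O ` A))" using U assms(1) by simp
    show "\<forall>X\<in>?O ` A. 4 dvd card X"
    proof
      fix X assume "X \<in> ?O ` A"
      then obtain x where x: "x \<in> A" "X = ?O x" by auto
      have "p (q x) \<noteq> p x" "p (q x) \<noteq> x" "p (q x) \<noteq> q x"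
        using ne pp qA x(1) by metis+
      then have "card X = 4" using x ne[OF x(1)] by simp
      then show "4 dvd card X" by simp
    qed
    show "\<forall>X\<in>?O ` A. \<forall>Y\<in>?O ` A. X \<noteq> Y \<longrightarrow> X \<inter> Y = {}"
    proof (intro ballI impI)
      fix X Y assume "X \<in> ?O ` A" "Y \<in> ?O ` A" "X \<noteq> Y"
      then obtain x y where xy: "x \<in> A" "y \<in> A" "X = ?O x" "Y = ?O y" by (elim imageE)
      have "X = Y" if z: "z \<in> X" "z \<in> Y" for z
      proof -
        have zA: "z \<in> A" using z(1) xy(1,3) pA qA by auto
        have eq: "?O w = ?O z" if "w \<in> A" "z \<in> ?O w" for w
        proof (rule equalityI)
          have e: "p (p w) = w" "q (q w) = w" "p (q (p (q w))) = w"
            using that(1) pA qA pp qq pq by simp_all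
          have "w \<in> ?O z" using that(2) by (elim insertE emptyE) (simp_all add: e)
          then show "?O w \<subseteq> ?O z" by (rule sub[OF zA])
        qed (rule sub[OF that])
        show "X = Y"
          using eq[OF xy(1) z(1)[unfolded xy(3)]] eq[OF xy(2) z(2)[unfolded xy(4)]]
          unfolding xy(3,4) by (rule trans[OF _ sym])
      qed
      then show "X \<inter> Y = {}" using \<open>X \<noteq> Y\<close> by blast
    qed
  qed
  then show ?thesis using U by simp
qed

text \<open>Parity repairs the one uncontrolled point. If \<open>p\<close> fixed \<open>k\<close>,
  it would act as a fixed-point-free involution on \<open>A - {k}\<close>, a set of odd size. So
  \<open>p k\<close> differs from \<open>k\<close>, and injectivity then forces
  \<open>p (p k) = k\<close>. This makes up for the one neighbour that an almost full vertex may
  miss.\<close>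

lemma involution_if_involution_off_point:
  assumes "finite A" "even (card A)" and p: "bij_betw p A A"
    and inv: "\<And>x. x \<in> A \<Longrightarrow> x \<noteq> k \<Longrightarrow> p x \<noteq> k \<Longrightarrow> p (p x) = x"
    and ne: "\<And>x. x \<in> A \<Longrightarrow> x \<noteq> k \<Longrightarrow> p x \<noteq> x"
  shows "\<forall>x\<in>A. p (p x) = x \<and> p x \<noteq> x"
proof (cases "k \<in> A")
  case False
  then show ?thesis using inv ne bij_betwE[OF p] by metis
next
  case True
  note pA = bij_betwE[OF p, rule_format] and inj = bij_betw_imp_inj_on[OF p]
  have neq: "p k \<noteq> k"
  proof
    assume k: "p k = k"
    have *: "p x \<noteq> k" if "x \<in> A - {k}" for x
      using that k inj True by (metis DiffE inj_onD insertI1)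
    have "even (card (A - {k}))"
      by (rule even_card_if_involution[of _ p]) (use assms(1) * pA inv ne in auto)
    then show False using assms(1,2) True by (metis card_Suc_Diff1 even_Suc)
  qed
  have pk: "p (p k) = k"
  proof (rule ccontr)
    assume "p (p k) \<noteq> k"
    then have "p (p (p k)) = p k" using inv[of "p k"] pA True neq by blast
    then show False using inj_onD[OF inj] pA True \<open>p (p k) \<noteq> k\<close> by blast
  qed
  show ?thesis
  proof (intro ballI conjI)
    fix x assume x: "x \<in> A"
    show "p x \<noteq> x" using neq ne x by metis
    show "p (p x) = x"
    proof (cases "p x = k")
      case True
      then have "x = p k" using pk inj_onD[OF inj] x pA \<open>k \<in> A\<close> by metis
      then show ?thesis using True by simp
    next
      case False
      then show ?thesis using inv pk x by metis
    qed
  qed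
qed

text \<open>Put \<open>p\<close>, \<open>q\<close>, \<open>r\<close> for the inverse of
  \<open>l\<close> after \<open>m\<close>, the inverse of \<open>l\<close> after \<open>n\<close>,
  and the inverse of \<open>m\<close> after \<open>n\<close>. The last three hypotheses make each of
  them an involution. Since \<open>r\<close> is \<open>p\<close> after \<open>q\<close>, its being
  an involution says that \<open>p\<close> and \<open>q\<close> commute; the labels differing
  pointwise makes the action free.\<close>

lemma four_dvd_card_if_labelings:
  assumes fin: "finite A" and bij: "bij_betw l A K" "bij_betw m A K" "bij_betw n A K"
    and ne: "\<And>x. x \<in> A \<Longrightarrow> l x \<noteq> m x" "\<And>x. x \<in> A \<Longrightarrow> l x \<noteq> n x" "\<And>x. x \<in> A \<Longrightarrow> m x \<noteq> n x"
    and lm: "\<And>x y. x \<in> A \<Longrightarrow> y \<in> A \<Longrightarrow> l y = m x \<Longrightarrow> l x = m y"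
    and ln: "\<And>x y. x \<in> A \<Longrightarrow> y \<in> A \<Longrightarrow> l y = n x \<Longrightarrow> l x = n y"
    and mn: "\<And>x y. x \<in> A \<Longrightarrow> y \<in> A \<Longrightarrow> m y = n x \<Longrightarrow> m x = n y"
  shows "4 dvd card A"
proof -
  define p where "p = (\<lambda>x. inv_into A l (m x))"
  define q where "q = (\<lambda>x. inv_into A l (n x))"
  define r where "r = (\<lambda>x. inv_into A m (n x))"
  have p: "p x \<in> A" "l (p x) = m x" and q: "q x \<in> A" "l (q x) = n x"
    and r: "r x \<in> A" "m (r x) = n x" if "x \<in> A" for x
  proof -
    have "m x \<in> l ` A" "n x \<in> l ` A" "n x \<in> m ` A"
      using that bij by (auto simp: bij_betw_def)
    then show "p x \<in> A" "l (p x) = m x" "q x \<in> A" "l (q x) = n x" "r x \<in> A" "m (r x) = n x"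
      unfolding p_def q_def r_def by (simp_all add: inv_into_into f_inv_into_f)
  qed
  have inj: "inj_on l A" "inj_on m A" "inj_on n A" using bij by (auto simp: bij_betw_def)
  have pp: "p (p x) = x" if "x \<in> A" for x
    using lm[OF that p(1)[OF that] p(2)[OF that]] p[OF p(1)[OF that]] that inj_onD[OF inj(1)] by metis
  have qq: "q (q x) = x" if "x \<in> A" for x
    using ln[OF that q(1)[OF that] q(2)[OF that]] q[OF q(1)[OF that]] that inj_onD[OF inj(1)] by metis
  have rr: "r (r x) = x" if "x \<in> A" for x
    using mn[OF that r(1)[OF that] r(2)[OF that]] r[OF r(1)[OF that]] that inj_onD[OF inj(2)] by metis
  have qpr: "q x = p (r x)" if "x \<in> A" for x
    using that p[of "r x"] q[of x] r[of x] inj_onD[OF inj(1)] by metis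
  have rpq: "r x = p (q x)" if "x \<in> A" for x
    using qpr[OF that] pp[OF r(1)[OF that]] by simp
  have pq: "p (q x) = q (p x)" if "x \<in> A" for x
  proof -
    have "p (q (p (q x))) = x" using rr[OF that] rpq[OF that] rpq[OF r(1)[OF that]] by simp
    then have "q (p (q x)) = p x" using pp[of "q (p (q x))"] that p(1) q(1) by simp
    then show ?thesis using qq[of "p (q x)"] that p(1) q(1) by simp
  qed
  show ?thesis
  proof (rule four_dvd_card_if_free_klein_action[of A p q])
    show "p x \<noteq> x" "q x \<noteq> x" "p x \<noteq> q x" if "x \<in> A" for x
      using ne[OF that] p(2)[OF that] q(2)[OF that] by auto
  qed (simp_all add: fin p(1) q(1) pp qq pq)
qed

section \<open>The upper bound\<close>

locale colored_graph =
  fixes V :: "'a set" and E :: "'a set set" and c :: "'a set \<Rightarrow> nat"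
  assumes finite_V: "finite V"
    and edge: "e \<in> E \<Longrightarrow> e \<subseteq> V \<and> card e = 2"
    and proper: "e \<in> E \<Longrightarrow> e' \<in> E \<Longrightarrow> e \<noteq> e' \<Longrightarrow> e \<inter> e' \<noteq> {} \<Longrightarrow> c e \<noteq> c e'"
begin

definition nbrs :: "'a \<Rightarrow> 'a set" where
  "nbrs v = {w. {v, w} \<in> E}"

abbreviation deg :: "'a \<Rightarrow> nat" where
  "deg v \<equiv> card (nbrs v)"

lemma nbrsD: "w \<in> nbrs v \<Longrightarrow> v \<in> V \<and> w \<in> V \<and> w \<noteq> v"
  using edge[of "{v, w}"] by (auto simp: nbrs_def)

lemma nbrs_sym: "w \<in> nbrs v \<longleftrightarrow> v \<in> nbrs w"
  by (simp add: nbrs_def insert_commute)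

lemma nbrs_subset: "nbrs v \<subseteq> V - {v}"
  using nbrsD by blast

lemma finite_nbrs: "finite (nbrs v)"
  using nbrs_subset finite_V by (meson finite_Diff finite_subset)

lemma finite_E: "finite E"
proof (rule finite_subset)
  show "E \<subseteq> Pow V" using edge by blast
qed (simp add: finite_V)

lemma properD:
  "x \<in> nbrs v \<Longrightarrow> y \<in> nbrs v \<Longrightarrow> c {v, x} = c {v, y} \<Longrightarrow> x = y"
  using proper[of "{v, x}" "{v, y}"] by (auto simp: nbrs_def doubleton_eq_iff)

lemma deg_eq_card_incident: "deg v = card {e \<in> E. v \<in> e}"
proof -
  have "bij_betw (\<lambda>w. {v, w}) (nbrs v) {e \<in> E. v \<in> e}"
  proof (rule bij_betw_imageI)
    show "inj_on (\<lambda>w. {v, w}) (nbrs v)" by (auto simp: inj_on_def doubleton_eq_iff)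
    have "e \<in> (\<lambda>w. {v, w}) ` nbrs v" if e: "e \<in> E" "v \<in> e" for e
    proof -
      obtain x y where "e = {x, y}" using edge[OF e(1)] by (auto simp: card_2_iff)
      then show ?thesis using e by (auto simp: nbrs_def insert_commute)
    qed
    then show "(\<lambda>w. {v, w}) ` nbrs v = {e \<in> E. v \<in> e}" by (auto simp: nbrs_def)
  qed
  then show ?thesis by (rule bij_betw_same_card)
qed

lemma handshake: "(\<Sum>v\<in>V. deg v) = 2 * card E"
proof -
  have "(\<Sum>v\<in>V. deg v) = (\<Sum>v\<in>V. card {e \<in> E. v \<in> e})"
    by (simp add: deg_eq_card_incident)
  also have "\<dots> = 2 * card E"
  proof (rule sum_multicount[OF finite_V finite_E])
    show "\<forall>e\<in>E. card {v \<in> V. v \<in> e} = 2"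
    proof
      fix e assume "e \<in> E"
      then have "{v \<in> V. v \<in> e} = e" "card e = 2" using edge by auto
      then show "card {v \<in> V. v \<in> e} = 2" by simp
    qed
  qed
  finally show ?thesis .
qed

end

text \<open>A rainbow path \<open>v, a, b, d\<close> serves as the handle; the set in the assumption collects the
  neighbours of \<open>v\<close> at which a bristle may end.\<close>

locale broom_free = colored_graph +
  fixes t :: nat
  assumes no_broom: "\<lbrakk>a \<in> nbrs v; b \<in> nbrs a; d \<in> nbrs b; b \<noteq> v; d \<noteq> v; d \<noteq> a; c {v, a} \<noteq> c {b, d}\<rbrakk> \<Longrightarrow>
    card {w \<in> nbrs v. w \<notin> {a, b, d} \<and> c {v, w} \<notin> {c {a, b}, c {b, d}}} < t - 3"
begin

text \<open>Neighbourhoods only shrink, and so do the sets of available bristles. This lets the edge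
  bound be proved by induction on the vertex set.\<close>

lemma broom_free_induced:
  assumes "S \<subseteq> V"
  shows "broom_free S {e \<in> E. e \<subseteq> S} c t"
proof -
  interpret S: colored_graph S "{e \<in> E. e \<subseteq> S}" c
    using assms finite_V edge proper by unfold_locales (auto intro: finite_subset)
  have sub: "S.nbrs v \<subseteq> nbrs v" for v by (auto simp: S.nbrs_def nbrs_def)
  show ?thesis
  proof
    fix a v b d
    assume H: "a \<in> S.nbrs v" "b \<in> S.nbrs a" "d \<in> S.nbrs b" "b \<noteq> v" "d \<noteq> v" "d \<noteq> a"
      "c {v, a} \<noteq> c {b, d}"
    have "card {w \<in> S.nbrs v. w \<notin> {a, b, d} \<and> c {v, w} \<notin> {c {a, b}, c {b, d}}}
      \<le> card {w \<in> nbrs v. w \<notin> {a, b, d} \<and> c {v, w} \<notin> {c {a, b}, c {b, d}}}"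
      by (rule card_mono) (use finite_nbrs sub in auto)
    also have "\<dots> < t - 3" using no_broom H sub by blast
    finally show "card {w \<in> S.nbrs v. w \<notin> {a, b, d} \<and> c {v, w} \<notin> {c {a, b}, c {b, d}}} < t - 3" .
  qed
qed

lemma blocked_path:
  assumes path: "a \<in> nbrs v" "b \<in> nbrs a" "d \<in> nbrs b" "b \<noteq> v" "d \<noteq> v" "d \<noteq> a"
    and rb: "c {v, a} \<noteq> c {b, d}" and deg: "t + 1 \<le> deg v"
  shows "deg v = t + 1" "b \<in> nbrs v" "\<exists>w\<in>nbrs v. c {v, w} = c {a, b}" "c {a, b} \<noteq> c {v, d}"
proof -
  let ?X = "{w \<in> nbrs v. w \<notin> {a, b, d} \<and> c {v, w} \<notin> {c {a, b}, c {b, d}}}"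
  let ?R = "{w \<in> nbrs v. w \<in> {a, b, d} \<or> c {v, w} \<in> {c {a, b}, c {b, d}}}"
  have "card ?X < t - 3" using no_broom[OF path rb] .
  moreover have "deg v = card (?X \<union> ?R)" by (rule arg_cong[of _ _ card]) auto
  moreover have "card (?X \<union> ?R) \<le> card ?X + card ?R" by (rule card_Un_le)
  ultimately have R: "deg v \<le> (t - 4) + card ?R" "4 \<le> t" by linarith+
  \<comment> \<open>By properness each colour leads from \<open>v\<close> to at most one neighbour.
    If a colour is absent at \<open>v\<close>, the corresponding \<open>x\<close> or
    \<open>y\<close> is an arbitrary element.\<close>
  have "\<exists>x. \<forall>w\<in>nbrs v. c {v, w} = k \<longrightarrow> w = x" for k
    using properD by metis
  then obtain x y where xy: "\<And>w. w \<in> nbrs v \<Longrightarrow> c {v, w} = c {a, b} \<Longrightarrow> w = x"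
    "\<And>w. w \<in> nbrs v \<Longrightarrow> c {v, w} = c {b, d} \<Longrightarrow> w = y" by metis
  have le: "card ?R \<le> length zs" if "?R \<subseteq> set zs" for zs
    using card_mono[OF _ that] card_length[of zs] by simp
  have "?R \<subseteq> set [a, b, d, x, y]" using xy by auto
  from le[OF this] have "card ?R \<le> 5" by simp
  then show "deg v = t + 1" using R deg by linarith
  have nle: "\<not> card ?R \<le> 4" using R deg by linarith
  show "b \<in> nbrs v"
  proof (rule ccontr)
    assume "b \<notin> nbrs v"
    then have "?R \<subseteq> set [a, d, x, y]" using xy by auto
    from le[OF this] nle show False by simp
  qed
  show "\<exists>w\<in>nbrs v. c {v, w} = c {a, b}"
  proof (rule ccontr)
    assume "\<not> ?thesis"
    then have "?R \<subseteq> set [a, b, d, y]" using xy by auto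
    from le[OF this] nle show False by simp
  qed
  show "c {a, b} \<noteq> c {v, d}"
  proof
    assume eq: "c {a, b} = c {v, d}"
    show False
    proof (cases "d \<in> nbrs v")
      case True
      then have "?R \<subseteq> set [a, b, d, y]" using eq xy(2) properD[of _ v d] by auto
      from le[OF this] nle show False by simp
    next
      case False
      then have "?R \<subseteq> set [a, b, x, y]" using xy by auto
      from le[OF this] nle show False by simp
    qed
  qed
qed

text \<open>The only neighbours of \<open>b\<close> that cannot serve as \<open>d\<close> are
  \<open>v\<close>, \<open>a\<close> and the one reached by the colour of \<open>va\<close>. If
  these are all of them, degree at least 3 forces all three to be present, in particular
  \<open>v\<close>.\<close>

lemma extend_path:
  assumes "a \<in> nbrs v" "b \<in> nbrs a" "b \<noteq> v" "3 \<le> deg b"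
  obtains (extension) d where "d \<in> nbrs b" "d \<noteq> v" "d \<noteq> a" "c {v, a} \<noteq> c {b, d}"
  | (blocked) "b \<in> nbrs v" "deg b = 3"
proof (cases "\<exists>d\<in>nbrs b. d \<noteq> v \<and> d \<noteq> a \<and> c {v, a} \<noteq> c {b, d}")
  case True
  then show ?thesis using extension by blast
next
  case False
  obtain x where x: "\<And>w. w \<in> nbrs b \<Longrightarrow> c {b, w} = c {v, a} \<Longrightarrow> w = x"
    using properD by metis
  have le: "deg b \<le> length zs" if "nbrs b \<subseteq> set zs" for zs
    using card_mono[OF _ that] card_length[of zs] by simp
  have sub: "nbrs b \<subseteq> {v, a, x}" using False x by fastforce
  then have "deg b \<le> 3" using le[of "[v, a, x]"] by simp
  moreover have "v \<in> nbrs b"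
  proof (rule ccontr)
    assume "v \<notin> nbrs b"
    then have "nbrs b \<subseteq> set [a, x]" using sub by auto
    from le[OF this] assms(4) show False by simp
  qed
  ultimately show ?thesis using blocked assms(4) nbrs_sym by auto
qed

end

section \<open>The structure of a minimal counterexample\<close>

locale minimal_dense = broom_free +
  assumes t_ge: "4 \<le> t" and t_dvd: "4 dvd t"
    and dense: "t * card V < 2 * card E"
    and minimal: "S \<subset> V \<Longrightarrow> 2 * card {e \<in> E. e \<subseteq> S} \<le> t * card S"
begin

text \<open>Deleting \<open>v\<close> removes \<open>deg v\<close> edges and lowers the bound on
  \<open>2|E|\<close> by only \<open>t\<close>, so a small degree would contradict
  minimality.\<close>

lemma deg_gt: assumes "v \<in> V" shows "t < 2 * deg v"
proof -
  have "E = {e \<in> E. e \<subseteq> V - {v}} \<union> {e \<in> E. v \<in> e}" using edge by auto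
  then have "card E = card ({e \<in> E. e \<subseteq> V - {v}} \<union> {e \<in> E. v \<in> e})" by simp
  also have "\<dots> \<le> card {e \<in> E. e \<subseteq> V - {v}} + deg v"
    unfolding deg_eq_card_incident by (rule card_Un_le)
  finally have "card E \<le> card {e \<in> E. e \<subseteq> V - {v}} + deg v" .
  moreover have "2 * card {e \<in> E. e \<subseteq> V - {v}} \<le> t * card (V - {v})"
    using minimal assms by blast
  moreover have "t * card V = t * card (V - {v}) + t"
    using card_Suc_Diff1[OF finite_V assms] by (metis mult_Suc_right add.commute)
  ultimately show ?thesis using dense by linarith
qed

lemma deg_ge_3: "v \<in> V \<Longrightarrow> 3 \<le> deg v"
  using deg_gt t_ge by fastforce

text \<open>Connectedness: otherwise no edge joins \<open>S\<close> to \<open>V - S\<close>, and the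
  bounds for these two smaller sets add up to the bound for \<open>V\<close>.\<close>

lemma eq_V_if_closed:
  assumes "S \<subseteq> V" "S \<noteq> {}" and closed: "\<And>x. x \<in> S \<Longrightarrow> nbrs x \<subseteq> S"
  shows "S = V"
proof (rule ccontr)
  assume "S \<noteq> V"
  have "e \<subseteq> S \<or> e \<subseteq> V - S" if eE: "e \<in> E" for e
  proof -
    obtain x y where "e = {x, y}" using edge[OF eE] by (auto simp: card_2_iff)
    then have "x \<in> nbrs y" "y \<in> nbrs x" "e = {x, y}"
      using eE by (auto simp: nbrs_def insert_commute)
    then show ?thesis using closed nbrsD by blast
  qed
  then have "E = {e \<in> E. e \<subseteq> S} \<union> {e \<in> E. e \<subseteq> V - S}" by blast
  then have "card E \<le> card {e \<in> E. e \<subseteq> S} + card {e \<in> E. e \<subseteq> V - S}"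
    by (metis card_Un_le)
  moreover have "2 * card {e \<in> E. e \<subseteq> S} \<le> t * card S"
    "2 * card {e \<in> E. e \<subseteq> V - S} \<le> t * card (V - S)"
    using minimal assms \<open>S \<noteq> V\<close> by blast+
  moreover have "card V = card S + card (V - S)"
    using assms(1) finite_V by (metis card_Diff_subset card_mono finite_subset le_add_diff_inverse)
  then have "t * card V = t * card S + t * card (V - S)" by (simp add: algebra_simps)
  ultimately show False using dense by linarith
qed

text \<open>Either the path \<open>v, a, b\<close> extends to a rainbow handle and
  \<open>blocked_path\<close> applies, or it cannot be extended and \<open>b\<close> has degree
  3.\<close>

lemma two_step:
  assumes "t + 1 \<le> deg v" "a \<in> nbrs v" "b \<in> nbrs a" "b \<noteq> v"
  shows "b \<in> nbrs v" "deg b = 3 \<or> deg v = t + 1 \<and> (\<exists>w\<in>nbrs v. c {v, w} = c {a, b})"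
proof -
  have "3 \<le> deg b" using deg_ge_3 nbrsD[OF assms(3)] by blast
  from assms(2,3,4) this
  have "b \<in> nbrs v \<and> (deg b = 3 \<or> deg v = t + 1 \<and> (\<exists>w\<in>nbrs v. c {v, w} = c {a, b}))"
  proof (cases rule: extend_path)
    case (extension d)
    from blocked_path[OF assms(2,3) extension(1) assms(4) extension(2-4) assms(1)]
    show ?thesis by blast
  qed simp
  then show "b \<in> nbrs v" "deg b = 3 \<or> deg v = t + 1 \<and> (\<exists>w\<in>nbrs v. c {v, w} = c {a, b})"
    by simp_all
qed

lemma V_eq_closed_nbrs:
  assumes "t + 1 \<le> deg v"
  shows "V = insert v (nbrs v)"
proof -
  have "nbrs v \<noteq> {}" using assms by auto
  then have "v \<in> V" using nbrsD by blast
  have "insert v (nbrs v) = V"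
  proof (rule eq_V_if_closed)
    show "insert v (nbrs v) \<subseteq> V" using \<open>v \<in> V\<close> nbrsD by blast
    show "nbrs x \<subseteq> insert v (nbrs v)" if "x \<in> insert v (nbrs v)" for x
      using that two_step(1)[OF assms, of x] by blast
  qed simp
  then show ?thesis by simp
qed

text \<open>A larger degree is incompatible with \<open>blocked_path\<close>, so no path from
  \<open>v\<close> extends and every neighbour of \<open>v\<close> has degree 3. As \<open>v\<close>
  is adjacent to all others, \<open>2|E| = 4 deg v < 4|V|\<close>, which is too sparse.\<close>

lemma deg_le_Suc_t: "deg v \<le> t + 1"
proof (rule ccontr)
  assume "\<not> deg v \<le> t + 1"
  then have v: "t + 1 \<le> deg v" "deg v \<noteq> t + 1" by simp_all
  have "deg b = 3" if b: "b \<in> nbrs v" for b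
  proof -
    have "\<not> nbrs b \<subseteq> {v}"
      using deg_ge_3 nbrsD[OF b] card_mono[of "{v}" "nbrs b"] by force
    then obtain a where a: "a \<in> nbrs b" "a \<noteq> v" by blast
    then have "a \<in> nbrs v" using two_step(1)[OF v(1) b] by blast
    moreover have "b \<in> nbrs a" "b \<noteq> v" using a(1) nbrs_sym nbrsD[OF b] by blast+
    ultimately show ?thesis using two_step(2)[OF v(1)] v(2) by blast
  qed
  then have "(\<Sum>w\<in>nbrs v. deg w) = 3 * deg v" by simp
  moreover have "v \<notin> nbrs v" using nbrsD by blast
  ultimately have "2 * card E = 4 * deg v"
    using handshake V_eq_closed_nbrs[OF v(1)] finite_nbrs[of v] by simp
  moreover have "card V = deg v + 1"
    using V_eq_closed_nbrs[OF v(1)] finite_nbrs[of v] \<open>v \<notin> nbrs v\<close> by simp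
  moreover have "4 * card V \<le> t * card V" using t_ge by simp
  ultimately show False using dense by linarith
qed

text \<open>The average degree exceeds \<open>t\<close>, so some vertex has degree
  \<open>t + 1\<close>, and it is adjacent to all others.\<close>

lemma card_V: "card V = t + 2"
proof -
  have "\<exists>v\<in>V. t < deg v"
  proof (rule ccontr)
    assume "\<not> ?thesis"
    then have "(\<Sum>v\<in>V. deg v) \<le> (\<Sum>v\<in>V. t)" by (intro sum_mono) auto
    then show False using dense handshake by (simp add: mult.commute)
  qed
  then obtain v where v: "v \<in> V" "t + 1 \<le> deg v" by auto
  have "v \<notin> nbrs v" using nbrsD by blast
  then have "card V = deg v + 1"
    using V_eq_closed_nbrs[OF v(2)] finite_nbrs[of v] by simp
  then show ?thesis using v(2) deg_le_Suc_t[of v] by simp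
qed

section \<open>Counting missing neighbours\<close>

definition defect :: "'a \<Rightarrow> nat" where
  "defect v = t + 1 - deg v"

lemma deg_add_defect: "deg v + defect v = t + 1"
  using deg_le_Suc_t[of v] by (simp add: defect_def)

lemma sum_defect: "(\<Sum>v\<in>V. defect v) \<le> t"
proof -
  have "(\<Sum>v\<in>V. deg v) + (\<Sum>v\<in>V. defect v) = (t + 2) * (t + 1)"
    by (simp add: sum.distrib[symmetric] deg_add_defect card_V)
  \<comment> \<open>As \<open>t\<close> is even, both sides of the strict inequality
    \<open>dense\<close> are even, which gains 2 instead of 1.\<close>
  moreover have "t * (t + 2) + 2 \<le> 2 * card E"
  proof -
    obtain k where "t = 2 * k" using t_dvd by auto
    then show ?thesis using dense unfolding card_V by simp presburger
  qed
  ultimately show ?thesis using handshake by (simp add: algebra_simps)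
qed

lemma sum_defect_subset: "S \<subseteq> V \<Longrightarrow> (\<Sum>v\<in>S. defect v) \<le> t"
  using sum_defect sum_mono2[OF finite_V, of S defect] by simp

definition full :: "'a \<Rightarrow> bool" where
  "full v \<longleftrightarrow> v \<in> V \<and> defect v = 0"

lemma nbrs_full: assumes "full v" shows "nbrs v = V - {v}"
proof (rule card_subset_eq)
  show "deg v = card (V - {v})"
    using assms finite_V card_V deg_add_defect[of v] by (simp add: full_def)
qed (use finite_V nbrs_subset in auto)

text \<open>The total defect is at most \<open>t\<close>. Hence at most \<open>t\<close> of the
  \<open>t + 2\<close> vertices have positive defect, and the \<open>t\<close> vertices other than
  \<open>u\<close> and \<open>v\<close> cannot all have defect at least 2.\<close>

lemma ex_full_full_almost_full:
  obtains u v a where "full u" "full v" "a \<in> V" "defect a \<le> 1" "u \<noteq> v" "u \<noteq> a" "v \<noteq> a"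
proof -
  let ?F = "{v. full v}"
  have FV: "?F \<subseteq> V" by (auto simp: full_def)
  have fF: "finite ?F" using FV finite_V finite_subset by blast
  have "card (V - ?F) \<le> (\<Sum>v\<in>V - ?F. defect v)"
    unfolding card_eq_sum by (rule sum_mono) (auto simp: full_def)
  also have "\<dots> \<le> t" by (rule sum_defect_subset) blast
  finally have "2 \<le> card ?F" using card_V fF FV by (simp add: card_Diff_subset)
  then obtain T where T: "T \<subseteq> ?F" "card T = 2" by (meson obtain_subset_with_card_n)
  then obtain u v where uv: "T = {u, v}" "u \<noteq> v" by (auto simp: card_2_iff)
  have "\<exists>a\<in>V - {u, v}. defect a \<le> 1"
  proof (rule ccontr)
    assume "\<not> ?thesis"
    then have "(\<Sum>a\<in>V - {u, v}. 2) \<le> (\<Sum>a\<in>V - {u, v}. defect a)"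
      by (intro sum_mono) (metis Suc_1 not_less_eq_eq One_nat_def)
    also have "\<dots> \<le> t" by (rule sum_defect_subset) blast
    finally have "card (V - {u, v}) * 2 \<le> t" by simp
    moreover have "{u, v} \<subseteq> V" using uv T FV by blast
    then have "card (V - {u, v}) = t"
      using uv card_V by (simp add: card_Diff_subset)
    ultimately show False using t_ge by linarith
  qed
  then show thesis using that uv T by auto
qed

text \<open>In the 4-cycle \<open>u, x, y, z\<close>, if one pair of opposite edges has equal
  colours, so does the other. Otherwise the path \<open>u, x, y, z\<close> meets the conditions of
  \<open>blocked_path\<close>, whose last conclusion contradicts \<open>eq\<close>.\<close>

lemma full_closure:
  assumes "full u" "y \<in> nbrs x" "z \<in> nbrs y" "x \<noteq> u" "y \<noteq> u" "z \<noteq> u" "z \<noteq> x"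
    and eq: "c {x, y} = c {u, z}"
  shows "c {y, z} = c {u, x}"
proof (rule ccontr)
  assume "c {y, z} \<noteq> c {u, x}"
  moreover have "x \<in> nbrs u" using nbrs_full assms nbrsD by blast
  moreover have "t + 1 \<le> deg u" using assms(1) deg_add_defect[of u] by (simp add: full_def)
  ultimately show False using blocked_path(4)[of x u y z] assms by metis
qed

text \<open>For an edge avoiding \<open>u\<close> with an end of degree other than 3,
  \<open>two_step\<close> finds its colour at \<open>u\<close>. Edges with both ends of degree 3 are
  ruled out by counting defects.\<close>

lemma colors_at_full:
  assumes "full u"
  shows "(\<lambda>w. c {u, w}) ` nbrs u = c ` E"
proof
  show "(\<lambda>w. c {u, w}) ` nbrs u \<subseteq> c ` E" by (auto simp: nbrs_def)
  have du: "t + 1 \<le> deg u" using assms deg_add_defect[of u] by (simp add: full_def)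
  have key: "c {x, y} \<in> (\<lambda>w. c {u, w}) ` nbrs u"
    if "y \<in> nbrs x" "x \<noteq> u" "y \<noteq> u" "deg y \<noteq> 3" for x y
  proof -
    have "x \<in> nbrs u" using nbrs_full assms nbrsD that by blast
    from two_step(2)[OF du this that(1,3)] that(4) show ?thesis by force
  qed
  show "c ` E \<subseteq> (\<lambda>w. c {u, w}) ` nbrs u"
  proof (rule image_subsetI)
    fix e assume e: "e \<in> E"
    then obtain x y where xy: "e = {x, y}" using edge[OF e] by (auto simp: card_2_iff)
    then have y: "y \<in> nbrs x" and x: "x \<in> nbrs y"
      using e by (auto simp: nbrs_def insert_commute)
    consider "x = u" | "y = u" | "x \<noteq> u" "y \<noteq> u" "deg y \<noteq> 3" | "x \<noteq> u" "y \<noteq> u" "deg x \<noteq> 3"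
      | "deg x = 3" "deg y = 3" by blast
    then show "c e \<in> (\<lambda>w. c {u, w}) ` nbrs u"
    proof cases
      case 1 then show ?thesis using xy y by blast
    next
      case 2 then show ?thesis using xy x by (auto simp: insert_commute)
    next
      case 3 then show ?thesis using key[OF y] xy by simp
    next
      case 4 then show ?thesis using key[OF x] xy by (simp add: insert_commute)
    next
      case 5
      \<comment> \<open>The defects of \<open>x\<close> and \<open>y\<close> add up to
        \<open>2t - 4\<close>. For \<open>t = 4\<close> this is still at most \<open>t\<close>, so a
        third vertex \<open>z\<close> of positive defect is taken: a non-neighbour of
        \<open>x\<close>.\<close>
      have "card (insert x (nbrs x)) \<le> 4"
        using 5 finite_nbrs[of x] by (simp add: card_insert_if)
      then have "insert x (nbrs x) \<noteq> V" using card_V t_ge by auto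
      then obtain z where z: "z \<in> V" "z \<noteq> x" "z \<notin> nbrs x" using nbrsD[OF y] nbrs_subset by blast
      then have "x \<notin> nbrs z" "z \<noteq> y" using nbrs_sym y by blast+
      then have "\<not> full z" using nbrs_full z nbrsD[OF y] by blast
      then have "1 \<le> defect z" using z by (simp add: full_def)
      moreover have "(\<Sum>v\<in>{x, y, z}. defect v) \<le> t"
        using sum_defect_subset nbrsD[OF y] z by simp
      ultimately have "defect x + defect y + 1 \<le> t"
        using z \<open>z \<noteq> y\<close> nbrsD[OF y] by auto
      then show ?thesis
        using deg_add_defect[of x] deg_add_defect[of y] 5 t_ge by linarith
    qed
  qed
qed

section \<open>Labelings of the vertices by colours\<close>

lemma card_colors: "card (c ` E) = t + 1"
proof -
  obtain u where u: "full u" using ex_full_full_almost_full by blast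
  have "card ((\<lambda>w. c {u, w}) ` nbrs u) = deg u"
    by (rule card_image) (meson inj_onI properD)
  then show ?thesis using colors_at_full[OF u] u deg_add_defect[of u] by (simp add: full_def)
qed

text \<open>\<open>None\<close> acts as the colour of a loop at \<open>v\<close>. With this extra
  value there are \<open>t + 2\<close> labels, as many as vertices, and the label function of a full
  vertex is a bijection.\<close>

definition label :: "'a \<Rightarrow> 'a \<Rightarrow> nat option" where
  "label v x = (if x = v then None else Some (c {v, x}))"

abbreviation labels :: "nat option set" where
  "labels \<equiv> insert None (Some ` c ` E)"

lemma card_labels: "card labels = card V"
  using card_V card_colors finite_E by (simp add: card_image)

text \<open>The exceptional vertex \<open>k\<close> is the possible non-neighbour of \<open>a\<close>; for a full vertex \<open>a\<close>
  it is \<open>a\<close> itself.\<close>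

definition labeling :: "'a \<Rightarrow> 'a \<Rightarrow> ('a \<Rightarrow> nat option) \<Rightarrow> bool" where
  "labeling a k l \<longleftrightarrow> bij_betw l V labels \<and> l a = None \<and> (k = a \<or> k \<notin> nbrs a) \<and>
     (\<forall>x\<in>V - {a, k}. x \<in> nbrs a \<and> l x = Some (c {a, x}))"

lemma bij_betw_labelsI:
  assumes "inj_on l V" "l ` V \<subseteq> labels"
  shows "bij_betw l V labels"
proof (rule bij_betw_imageI[OF assms(1)])
  show "l ` V = labels"
    by (rule card_subset_eq) (use assms card_labels finite_E card_image in auto)
qed

lemma labeling_full:
  assumes "full v"
  shows "labeling v v (label v)"
proof -
  have "bij_betw (label v) V labels"
  proof (rule bij_betw_labelsI)
    show "inj_on (label v) V"
      using properD nbrs_full[OF assms] by (auto simp: label_def inj_on_def)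
    show "label v ` V \<subseteq> labels"
      using nbrs_full[OF assms] by (auto simp: label_def nbrs_def)
  qed
  then show ?thesis using nbrs_full[OF assms] by (auto simp: labeling_def label_def)
qed

text \<open>A vertex of defect 1 has one non-neighbour \<open>k\<close> and sees at most
  \<open>t\<close> of the \<open>t + 1\<close> colours; giving a colour \<open>\<beta>\<close>
  absent at \<open>a\<close> to \<open>k\<close> completes the bijection.\<close>

lemma ex_labeling:
  assumes a: "a \<in> V" "defect a \<le> 1"
  shows "\<exists>k l. labeling a k l"
proof (cases "defect a = 0")
  case True
  then show ?thesis using labeling_full a by (auto simp: full_def)
next
  case False
  then have deg: "deg a = t" using a deg_add_defect[of a] by simp
  then have "card (V - {a} - nbrs a) = 1"
    using card_V a finite_V finite_nbrs nbrs_subset[of a] by (simp add: card_Diff_subset)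
  then obtain k where k: "V - {a} - nbrs a = {k}" by (auto simp: card_1_singleton_iff)
  let ?Ca = "(\<lambda>x. c {a, x}) ` nbrs a"
  have "card ?Ca \<le> t" using deg card_image_le[OF finite_nbrs] by metis
  moreover have "?Ca \<subseteq> c ` E" by (auto simp: nbrs_def)
  ultimately have "?Ca \<subset> c ` E" using card_colors by fastforce
  then obtain \<beta> where \<beta>: "\<beta> \<in> c ` E" "\<beta> \<notin> ?Ca" by blast
  let ?l = "(label a)(k := Some \<beta>)"
  have ka: "k \<noteq> a" "k \<in> V" "k \<notin> nbrs a" and nb: "\<And>x. x \<in> V \<Longrightarrow> x \<noteq> a \<Longrightarrow> x \<noteq> k \<Longrightarrow> x \<in> nbrs a"
    using k by auto
  have "bij_betw ?l V labels"
  proof (rule bij_betw_labelsI)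
    show "inj_on ?l V"
    proof (rule inj_onI)
      fix x y assume xy: "x \<in> V" "y \<in> V" "?l x = ?l y"
      then show "x = y"
        using nb[of x] nb[of y] \<beta>(2) properD[of x a y] ka
        by (auto simp: label_def split: if_splits)
    qed
    show "?l ` V \<subseteq> labels"
      using nb \<beta>(1) by (auto simp: label_def nbrs_def)
  qed
  then have "labeling a k ?l" using nb ka by (auto simp: labeling_def label_def)
  then show ?thesis by blast
qed

text \<open>The conclusions say that \<open>p\<close>, the inverse of \<open>label u\<close> after
  \<open>l\<close>, has no fixed point and is an involution. Away from \<open>k\<close> this comes
  from properness and \<open>full_closure\<close>; at \<open>k\<close> it comes from
  \<open>involution_if_involution_off_point\<close>, as \<open>|V| = t + 2\<close> is even.\<close>

lemma labeling_involution:
  assumes u: "full u" and l: "labeling a k l" and a: "a \<in> V" "a \<noteq> u"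
  shows "\<forall>x\<in>V. label u x \<noteq> l x" "\<forall>x\<in>V. \<forall>y\<in>V. label u y = l x \<longrightarrow> label u x = l y"
proof -
  have uV: "u \<in> V" using u by (simp add: full_def)
  have au: "a \<in> nbrs u" "u \<in> nbrs a" using nbrs_full[OF u] a nbrs_sym by blast+
  have lb: "bij_betw l V labels" and la: "l a = None" and ku: "k \<noteq> u"
    and lx: "\<And>x. x \<in> V \<Longrightarrow> x \<noteq> a \<Longrightarrow> x \<noteq> k \<Longrightarrow> x \<in> nbrs a \<and> l x = Some (c {a, x})"
    using l a au by (auto simp: labeling_def)
  have ub: "bij_betw (label u) V labels" using labeling_full[OF u] by (simp add: labeling_def)
  have inju: "inj_on (label u) V" using ub by (simp add: bij_betw_def)
  have lu: "l u = Some (c {a, u})" using lx[OF uV] a ku by auto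
  define p where "p = (\<lambda>x. inv_into V (label u) (l x))"
  have bp: "bij_betw p V V"
    using bij_betw_trans[OF lb bij_betw_inv_into[OF ub]] by (simp add: p_def comp_def)
  have pV: "p x \<in> V" and lp: "label u (p x) = l x" if "x \<in> V" for x
    using bij_betwE[OF bp] that bij_betw_inv_into_right[OF ub] bij_betwE[OF lb]
    by (auto simp: p_def)
  have pI: "p x = y" if "x \<in> V" "y \<in> V" "label u y = l x" for x y
    using lp[OF that(1)] pV[OF that(1)] that inju by (metis inj_onD)
  have step: "label u x = l y"
    if xy: "x \<in> V" "y \<in> V" "label u y = l x" "x \<noteq> k" "y \<noteq> k" for x y
  proof -
    \<comment> \<open>The loop label makes \<open>p\<close> swap \<open>a\<close> and
      \<open>u\<close>. For any other \<open>x\<close>, the vertices \<open>u, x, a, y\<close> form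
      a 4-cycle to which \<open>full_closure\<close> applies.\<close>
    consider "x = a" | "x = u" | "x \<noteq> a" "x \<noteq> u" by blast
    then show ?thesis
    proof cases
      case 1
      then have "y = u" using xy la by (auto simp: label_def split: if_splits)
      then show ?thesis using 1 lu a by (simp add: label_def insert_commute)
    next
      case 2
      then have "label u y = label u a"
        using xy lu a by (simp add: label_def insert_commute)
      then have "y = a" using inju xy a by (metis inj_onD)
      then show ?thesis using 2 la by (simp add: label_def)
    next
      case 3
      have x: "x \<in> nbrs a" "l x = Some (c {a, x})" using lx xy 3 by blast+
      then have "y \<noteq> u" and eq: "c {u, y} = c {a, x}"
        using xy(3) by (auto simp: label_def split: if_splits)
      have "y \<noteq> a"
      proof
        assume "y = a"
        then have "c {a, u} = c {a, x}" using eq by (simp add: insert_commute)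
        then show False using properD[OF au(2) x(1)] 3 by simp
      qed
      then have y: "y \<in> nbrs a" "l y = Some (c {a, y})" using lx xy by blast+
      have "y \<noteq> x"
      proof
        assume "y = x"
        then have "c {x, u} = c {x, a}" using eq by (simp add: insert_commute)
        moreover have "u \<in> nbrs x" using nbrs_full[OF u] xy 3 nbrs_sym by blast
        ultimately show False using properD[of u x a] x(1) nbrs_sym a by blast
      qed
      then have "c {a, y} = c {u, x}"
        using full_closure[OF u, of a x y] x y 3 a \<open>y \<noteq> u\<close> eq nbrs_sym by (metis insert_commute)
      then show ?thesis using y 3 by (simp add: label_def)
    qed
  qed
  have P: "\<forall>x\<in>V. p (p x) = x \<and> p x \<noteq> x"
  proof (rule involution_if_involution_off_point[OF finite_V _ bp])
    show "even (card V)" using card_V t_dvd by auto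
    show "p (p x) = x" if "x \<in> V" "x \<noteq> k" "p x \<noteq> k" for x
      using step[of x "p x"] pI[of "p x" x] that pV lp by simp
    show "p x \<noteq> x" if x: "x \<in> V" "x \<noteq> k" for x
    \<comment> \<open>A fixed point would give the edges from \<open>x\<close> to \<open>u\<close>
      and to \<open>a\<close> the same colour.\<close>
    proof
      assume "p x = x"
      then have eq: "label u x = l x" using lp x by metis
      then have "x \<noteq> a" using la a by (auto simp: label_def)
      moreover have "x \<noteq> u" using eq lu by (auto simp: label_def)
      ultimately have "x \<in> nbrs a" "c {x, u} = c {x, a}" "u \<in> nbrs x"
        using eq lx[of x] x nbrs_full[OF u] nbrs_sym by (auto simp: label_def insert_commute)
      then show False using properD[of u x a] nbrs_sym a by blast
    qed
  qed
  show "\<forall>x\<in>V. label u x \<noteq> l x" using P pI by metis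
  show "\<forall>x\<in>V. \<forall>y\<in>V. label u y = l x \<longrightarrow> label u x = l y" using P pI lp pV by metis
qed

lemma contradiction: False
proof -
  obtain u v a where uva: "full u" "full v" "a \<in> V" "defect a \<le> 1" "u \<noteq> v" "u \<noteq> a" "v \<noteq> a"
    by (rule ex_full_full_almost_full)
  obtain k l where l: "labeling a k l" using ex_labeling uva by blast
  have "v \<in> V" using uva by (simp add: full_def)
  note inv = labeling_involution[OF uva(1) labeling_full[OF uva(2)] this uva(5)[symmetric]]
    labeling_involution[OF uva(1) l uva(3) uva(6)[symmetric]]
    labeling_involution[OF uva(2) l uva(3) uva(7)[symmetric]]
  have "4 dvd card V"
  proof (rule four_dvd_card_if_labelings[of V "label u" labels "label v" l])
    show "bij_betw (label u) V labels" "bij_betw (label v) V labels" "bij_betw l V labels"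
      using labeling_full uva l by (auto simp: labeling_def)
  qed (use finite_V inv in blast)+
  then have "4 dvd t + 2" by (simp add: card_V)
  then have "4 dvd (2::nat)" using t_dvd dvd_add_right_iff by blast
  then show False by simp
qed

end

text \<open>Strong induction on the number of vertices: the induction hypothesis, applied to induced
  subgraphs, makes a counterexample an instance of \<open>minimal_dense\<close>, which is
  inconsistent.\<close>

theorem (in broom_free) edge_bound:
  assumes t: "4 \<le> t" "4 dvd t"
  shows "2 * card E \<le> t * card V"
proof -
  have "broom_free W F c t \<Longrightarrow> 2 * card F \<le> t * card W" for W F
  proof (induction "card W" arbitrary: W F rule: less_induct)
    case less
    interpret W: broom_free W F c t by (rule less.prems)
    show ?case
    proof (rule ccontr)
      assume "\<not> ?case"
      then have "minimal_dense W F c t"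
      proof unfold_locales
        show "2 * card {e \<in> F. e \<subseteq> S} \<le> t * card S" if "S \<subset> W" for S
          using less.hyps[of S] W.broom_free_induced psubset_card_mono[OF W.finite_V that] that
          by blast
      qed (use t in auto)
      then show False by (rule minimal_dense.contradiction)
    qed
  qed
  then show ?thesis using broom_free_axioms by blast
qed

section \<open>From rainbow subgraphs to forbidden paths with bristles\<close>

lemma edges_broom_3:
  "edges (broom t 3) = {{0, 1}, {1, 2}, {2, 3}} \<union> (\<lambda>j. {3, j}) ` {4..t}"
proof -
  have "{{i, i + 1} | i. i < (3::nat)} = (\<lambda>i. {i, i + 1}) ` {0, 1, 2}"
    by (auto simp: eval_nat_numeral less_Suc_eq)
  moreover have "{{3, j} | j. j \<in> {3 + 1..t}} = (\<lambda>j. {3, j}) ` {4..t}" by auto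
  ultimately show ?thesis by (simp add: broom_def eval_nat_numeral)
qed

lemma isomorphic_image:
  assumes F: "fin_simple_graph F" and f: "inj_on f (verts F)"
  shows "isomorphic F (f ` verts F, (`) f ` edges F)"
    "fin_simple_graph (f ` verts F, (`) f ` edges F)"
proof -
  have sub: "e \<subseteq> verts F" "card e = 2" if "e \<in> edges F" for e
    using F that by (simp_all add: fin_simple_graph_def)
  have iff: "{u, v} \<in> edges F \<longleftrightarrow> {f u, f v} \<in> (`) f ` edges F"
    if uv: "u \<in> verts F" "v \<in> verts F" for u v
  proof
    assume "{f u, f v} \<in> (`) f ` edges F"
    then obtain e where e: "e \<in> edges F" "{f u, f v} = f ` e" by (elim imageE)
    have "f ` {u, v} = f ` e" using e(2) by simp
    moreover have "{u, v} \<subseteq> verts F" using uv by simp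
    ultimately have "{u, v} = e" using inj_on_image_eq_iff[OF f _ sub(1)[OF e(1)]] by blast
    then show "{u, v} \<in> edges F" using e by simp
  next
    assume "{u, v} \<in> edges F"
    then show "{f u, f v} \<in> (`) f ` edges F" by (intro image_eqI[of _ _ "{u, v}"]) simp_all
  qed
  show "isomorphic F (f ` verts F, (`) f ` edges F)"
    unfolding isomorphic_def fst_conv snd_conv
  proof (intro exI[of _ f] conjI ballI)
    show "bij_betw f (verts F) (f ` verts F)" using f by (rule inj_on_imp_bij_betw)
  qed (rule iff)
  have "card (f ` e) = 2" if "e \<in> edges F" for e
    using sub[OF that] card_image[OF inj_on_subset[OF f sub(1)[OF that]]] by simp
  moreover have "f ` e \<subseteq> f ` verts F" if "e \<in> edges F" for e
    using sub(1)[OF that] by (rule image_mono)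
  moreover have "finite (verts F)" using F by (simp add: fin_simple_graph_def)
  ultimately show "fin_simple_graph (f ` verts F, (`) f ` edges F)"
    by (simp add: fin_simple_graph_def)
qed

text \<open>\<open>isomorphic\<close> only compares pairs of vertices; this determines the edge sets
  because all edges of both graphs have two elements.\<close>

lemma edges_eq_image_if_isomorphism:
  assumes F: "fin_simple_graph F" and H: "fin_simple_graph H"
    and f: "bij_betw f (verts F) (verts H)"
    and iff: "\<forall>u\<in>verts F. \<forall>v\<in>verts F. {u, v} \<in> edges F \<longleftrightarrow> {f u, f v} \<in> edges H"
  shows "edges H = (`) f ` edges F"
proof
  show "edges H \<subseteq> (`) f ` edges F"
  proof
    fix e assume e: "e \<in> edges H"
    then have "card e = 2" "e \<subseteq> f ` verts F"
      using H f by (auto simp: fin_simple_graph_def bij_betw_def)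
    then obtain u v where "u \<in> verts F" "v \<in> verts F" "e = {f u, f v}"
      unfolding card_2_iff by blast
    then show "e \<in> (`) f ` edges F" using iff e by (intro image_eqI[of _ _ "{u, v}"]) simp_all
  qed
  show "(`) f ` edges F \<subseteq> edges H"
  proof
    fix e assume "e \<in> (`) f ` edges F"
    then obtain d where d: "d \<in> edges F" "e = f ` d" by auto
    then have "card d = 2" "d \<subseteq> verts F" using F by (simp_all add: fin_simple_graph_def)
    then obtain u v where "d = {u, v}" "u \<in> verts F" "v \<in> verts F"
      unfolding card_2_iff by blast
    then show "e \<in> edges H" using iff d by simp
  qed
qed

lemma inj_on_UnI:
  "inj_on f A \<Longrightarrow> inj_on f B \<Longrightarrow> f ` A \<inter> f ` B = {} \<Longrightarrow> inj_on f (A \<union> B)"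
  unfolding inj_on_Un by blast

lemma broom_free_if_rainbow_free:
  assumes G: "fin_simple_graph G" and c: "proper_edge_coloring G c"
    and free: "\<And>H. is_subgraph H G \<Longrightarrow> isomorphic (broom t 3) H \<Longrightarrow> \<not> rainbow c H"
    and t: "3 \<le> t"
  shows "broom_free (verts G) (edges G) c t"
proof -
  interpret colored_graph "verts G" "edges G" c
    using G c by unfold_locales (auto simp: fin_simple_graph_def proper_edge_coloring_def)
  show ?thesis
  proof
    fix a v b d
    assume path: "a \<in> nbrs v" "b \<in> nbrs a" "d \<in> nbrs b" and ne: "b \<noteq> v" "d \<noteq> v" "d \<noteq> a"
      and rb: "c {v, a} \<noteq> c {b, d}"
    let ?X = "{w \<in> nbrs v. w \<notin> {a, b, d} \<and> c {v, w} \<notin> {c {a, b}, c {b, d}}}"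
    show "card ?X < t - 3"
    proof (rule ccontr)
      assume "\<not> ?thesis"
      then obtain Y where Y: "Y \<subseteq> ?X" "card Y = t - 3" "finite Y"
        by (meson not_less obtain_subset_with_card_n)
      have "card {4..t} = card Y" using Y by simp
      then obtain g where g: "bij_betw g {4..t} Y"
        using Y(3) finite_same_card_bij by blast
      \<comment> \<open>The bristles of the broom sit at vertex 3, so the handle
        \<open>0, 1, 2, 3\<close> is mapped to the path \<open>v, a, b, d\<close> read
        backwards.\<close>
      define f where "f = (\<lambda>j::nat. if j = 0 then d else if j = 1 then b else if j = 2 then a
        else if j = 3 then v else g j)"
      have f: "f 0 = d" "f (Suc 0) = b" "f 2 = a" "f 3 = v" "\<And>j. 4 \<le> j \<Longrightarrow> f j = g j"
        by (auto simp: f_def)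
      have vs: "{0..t} = {0, 1, 2, 3} \<union> {4..t}" using t by auto
      have gY: "g ` {4..t} = Y" using g by (simp add: bij_betw_def)
      have f4: "f ` {4..t} = Y" using gY f(5) image_cong[of "{4..t}" "{4..t}" f g] by simp
      have path': "v \<noteq> a" "a \<noteq> b" "b \<noteq> d"
        using nbrsD[OF path(1)] nbrsD[OF path(2)] nbrsD[OF path(3)] by blast+
      have Yv: "w \<in> nbrs v" "w \<noteq> v" "w \<noteq> a" "w \<noteq> b" "w \<noteq> d" "c {v, w} \<noteq> c {a, b}" "c {v, w} \<noteq> c {b, d}"
        if "w \<in> Y" for w
      proof -
        have "w \<in> ?X" using that Y(1) by blast
        then show "w \<in> nbrs v" "w \<noteq> a" "w \<noteq> b" "w \<noteq> d" "c {v, w} \<noteq> c {a, b}" "c {v, w} \<noteq> c {b, d}"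
          by simp_all
        then show "w \<noteq> v" using nbrsD[of w v] by simp
      qed
      have inj: "inj_on f {0..t}"
        unfolding vs
      proof (rule inj_on_UnI)
        show "inj_on f {0, 1, 2, 3}" using ne path' f(1-4) by (simp add: inj_on_def)
        show "inj_on f {4..t}" using g f(5) by (auto simp: bij_betw_def inj_on_def)
        have "v \<notin> Y" "a \<notin> Y" "b \<notin> Y" "d \<notin> Y" using Yv(2-5) by blast+
        then show "f ` {0, 1, 2, 3} \<inter> f ` {4..t} = {}" unfolding f4 by (simp add: f(1-4))
      qed
      let ?F = "broom t 3"
      let ?H = "(f ` verts ?F, (`) f ` edges ?F)"
      have vF: "verts ?F = {0..t}" by (simp add: broom_def)
      have iso: "isomorphic ?F ?H" and simple: "fin_simple_graph ?H"
        using isomorphic_image[OF fin_simple_graph_broom[OF t]] inj vF by auto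
      have "(\<lambda>j. f ` {3, j}) ` {4..t} = (\<lambda>w. {v, w}) ` Y"
        unfolding f4[symmetric] image_image using f(4) by simp
      then have eH: "edges ?H = {{v, a}, {a, b}, {b, d}} \<union> (\<lambda>w. {v, w}) ` Y"
        unfolding edges_broom_3 image_Un image_image using f(1-4)
        by (simp add: image_Un image_image insert_commute)
      have Hsub: "edges ?H \<subseteq> edges G"
        unfolding eH using path Yv(1) by (auto simp: nbrs_def)
      have vH: "verts ?H = {d, b, a, v} \<union> Y" using f(1-4) f4 by (simp add: vF vs image_Un)
      have "Y \<subseteq> verts G" using nbrsD[OF Yv(1)] by blast
      then have "verts ?H \<subseteq> verts G"
        unfolding vH using nbrsD[OF path(1)] nbrsD[OF path(2)] nbrsD[OF path(3)] by simp
      then have "is_subgraph ?H G" using simple Hsub by (simp add: is_subgraph_def)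
      moreover have "rainbow c ?H"
      proof -
        \<comment> \<open>Edges sharing a vertex differ in colour by properness. The disjoint pairs
          are \<open>va\<close> with \<open>bd\<close>, covered by \<open>rb\<close>, and bristles
          with \<open>ab\<close> or \<open>bd\<close>, covered by the choice of
          \<open>?X\<close>.\<close>
        have 1: "c {v, a} \<noteq> c {a, b}"
          using properD[of v a b] path(2) ne(1) path(1)[unfolded nbrs_sym[of a v]]
          by (auto simp: insert_commute)
        have 2: "c {a, b} \<noteq> c {b, d}"
          using properD[of a b d] path(3) ne(3) path(2)[unfolded nbrs_sym[of b a]]
          by (auto simp: insert_commute)
        have 3: "c {v, w} \<noteq> c {v, a}" if "w \<in> Y" for w
          using properD[of w v a] path(1) Yv(1,3)[OF that] by blast
        have 4: "inj_on (\<lambda>w. c {v, w}) Y"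
          by (rule inj_onI) (rule properD[OF Yv(1) Yv(1)])
        have "inj_on c {{v, a}, {a, b}, {b, d}}"
          using 1 2 rb by (simp add: inj_on_def)
        moreover have "inj_on c ((\<lambda>w. {v, w}) ` Y)"
          using 4 by (simp add: inj_on_def) metis
        moreover have "c ` {{v, a}, {a, b}, {b, d}} \<inter> c ` (\<lambda>w. {v, w}) ` Y = {}"
        proof -
          have "c {v, w} \<notin> {c {v, a}, c {a, b}, c {b, d}}" if "w \<in> Y" for w
            using 3[OF that] Yv(6,7)[OF that] by simp
          then show ?thesis by (simp only: disjoint_iff image_insert image_empty) blast
        qed
        ultimately have "inj_on c ({{v, a}, {a, b}, {b, d}} \<union> (\<lambda>w. {v, w}) ` Y)"
          by (rule inj_on_UnI)
        then show ?thesis unfolding rainbow_def eH .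
      qed
      ultimately show False using free[OF _ iso] by simp
    qed
  qed
qed

lemma rainbow_free_edge_bound:
  assumes "fin_simple_graph G" "rainbow_free (broom t 3) G" "4 \<le> t" "4 dvd t"
  shows "2 * card (edges G) \<le> t * card (verts G)"
proof -
  obtain c where "proper_edge_coloring G c"
    "\<And>H. is_subgraph H G \<Longrightarrow> isomorphic (broom t 3) H \<Longrightarrow> \<not> rainbow c H"
    using assms(2) unfolding rainbow_free_def by blast
  from broom_free_if_rainbow_free[OF assms(1) this] assms(3)
  have "broom_free (verts G) (edges G) c t" by simp
  then show ?thesis using broom_free.edge_bound assms by blast
qed

section \<open>The lower bound\<close>

unbundle bit_operations_syntax

text \<open>Adjacent numbers differ in bit \<open>s\<close> and agree in all higher bits. For
  \<open>m\<close> a multiple of \<open>2 ^ (s + 1)\<close>, each block of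
  \<open>2 ^ (s + 1)\<close> consecutive numbers below \<open>m\<close> carries a complete bipartite
  graph with sides given by bit \<open>s\<close>; the vertices from \<open>m\<close> on are
  isolated.\<close>

definition xor_graph :: "nat \<Rightarrow> nat \<Rightarrow> nat \<Rightarrow> nat graph" where
  "xor_graph s m n = ({..<n}, {{x, y} | x y. x < m \<and> y < m \<and> drop_bit s (x XOR y) = 1})"

definition xor_color :: "nat set \<Rightarrow> nat" where
  "xor_color e = (THE k. \<exists>x y. e = {x, y} \<and> k = x XOR y)"

lemma xor_color [simp]: "xor_color {x, y} = x XOR y"
  unfolding xor_color_def
  by (rule the_equality) (auto simp: doubleton_eq_iff xor.commute)

lemma xor_cancel: "(x::nat) XOR (x XOR y) = y"
  by (simp add: xor.assoc[symmetric])

lemma drop_bit_eq_1_iff: "drop_bit s (z::nat) = 1 \<longleftrightarrow> z \<in> {2 ^ s..<2 * 2 ^ s}"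
proof -
  have "drop_bit s z = 1 \<longleftrightarrow> 1 \<le> z div 2 ^ s \<and> z div 2 ^ s < 2"
    by (auto simp: drop_bit_eq_div)
  then show ?thesis by (simp add: less_eq_div_iff_mult_less_eq div_less_iff_less_mult)
qed

text \<open>The highest bit of \<open>z\<close> is bit \<open>s\<close>, so adding \<open>z\<close>
  stays within a block of \<open>2 ^ (s + 1)\<close> numbers.\<close>

lemma xor_less_iff:
  fixes x z :: nat
  assumes "drop_bit s z = 1"
  shows "x XOR z < 2 * 2 ^ s * k \<longleftrightarrow> x < 2 * 2 ^ s * k"
proof -
  have "z < 2 ^ Suc s" using assms unfolding drop_bit_eq_1_iff by simp
  then have "drop_bit (Suc s) z = 0" by (simp only: drop_bit_eq_div div_less)
  then have "drop_bit (Suc s) (x XOR z) = drop_bit (Suc s) x" by (simp only: drop_bit_xor xor.right_neutral)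
  moreover have "y < 2 * 2 ^ s * k \<longleftrightarrow> drop_bit (Suc s) y < k" for y :: nat
    by (simp add: drop_bit_eq_div div_less_iff_less_mult mult.commute)
  ultimately show ?thesis by simp
qed

lemma fin_simple_graph_xor_graph:
  assumes "m \<le> n"
  shows "fin_simple_graph (xor_graph s m n)"
proof -
  have "e \<subseteq> {..<n} \<and> card e = 2" if "e \<in> edges (xor_graph s m n)" for e
  proof -
    obtain x y where xy: "e = {x, y}" "x < m" "y < m" "drop_bit s (x XOR y) = 1"
      using \<open>e \<in> edges (xor_graph s m n)\<close> unfolding xor_graph_def snd_conv by blast
    then have "x \<noteq> y" by (intro notI) simp
    then show ?thesis using xy assms by simp
  qed
  then show ?thesis by (simp add: fin_simple_graph_def xor_graph_def)
qed

lemma xor_graph_edge_iff: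
  "{x, y} \<in> edges (xor_graph s m n) \<longleftrightarrow> x < m \<and> y < m \<and> drop_bit s (x XOR y) = 1"
  by (auto simp: xor_graph_def doubleton_eq_iff xor.commute)

lemma proper_xor_color: "proper_edge_coloring (xor_graph s m n) xor_color"
  unfolding proper_edge_coloring_def
proof (intro ballI impI)
  fix e e' assume e: "e \<in> edges (xor_graph s m n)" "e' \<in> edges (xor_graph s m n)"
    "e \<noteq> e' \<and> e \<inter> e' \<noteq> {}"
  then obtain v where v: "v \<in> e" "v \<in> e'" by blast
  obtain x where x: "e = {v, x}" using e(1) v(1) by (auto simp: xor_graph_def)
  obtain y where y: "e' = {v, y}" using e(2) v(2) by (auto simp: xor_graph_def)
  show "xor_color e \<noteq> xor_color e'"
  proof
    assume "xor_color e = xor_color e'"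
    then have "v XOR x = v XOR y" by (simp only: x y xor_color)
    then have "x = y" by (metis xor_cancel)
    then show False using e(3) x y by blast
  qed
qed

lemma card_edges_xor_graph:
  assumes m: "m = 2 * 2 ^ s * k" and "m \<le> n"
  shows "2 * card (edges (xor_graph s m n)) = 2 ^ s * m"
proof -
  let ?E = "edges (xor_graph s m n)"
  \<comment> \<open>The isolated vertices are dropped, so that the graph is regular of degree
    \<open>2 ^ s\<close> and the handshake identity counts its edges.\<close>
  interpret colored_graph "{..<m}" ?E xor_color
  proof
    show "e \<subseteq> {..<m} \<and> card e = 2" if "e \<in> ?E" for e
      using that fin_simple_graph_xor_graph[OF order_refl, of s m]
      by (simp add: fin_simple_graph_def xor_graph_def)
    show "xor_color e \<noteq> xor_color e'" if "e \<in> ?E" "e' \<in> ?E" "e \<noteq> e'" "e \<inter> e' \<noteq> {}" for e e'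
      using proper_xor_color[of s m n] that by (simp add: proper_edge_coloring_def)
  qed simp
  have "deg v = 2 ^ s" if v: "v \<in> {..<m}" for v
  proof -
    have "nbrs v = (XOR) v ` {2 ^ s..<2 * 2 ^ s}"
    proof (intro equalityI subsetI)
      fix w assume "w \<in> nbrs v"
      then have "drop_bit s (v XOR w) = 1" by (simp add: nbrs_def xor_graph_edge_iff)
      then show "w \<in> (XOR) v ` {2 ^ s..<2 * 2 ^ s}"
        unfolding drop_bit_eq_1_iff by (intro image_eqI[of _ _ "v XOR w"]) (simp_all add: xor_cancel)
    next
      fix w assume "w \<in> (XOR) v ` {2 ^ s..<2 * 2 ^ s}"
      then obtain z where z: "w = v XOR z" "drop_bit s z = 1" unfolding drop_bit_eq_1_iff by blast
      then show "w \<in> nbrs v"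
        using v xor_less_iff[OF z(2), of v k, folded m]
        by (simp add: nbrs_def xor_graph_edge_iff xor_cancel)
    qed
    moreover have "inj ((XOR) v)" by (metis injI xor_cancel)
    ultimately have "deg v = card {2 ^ s..<2 * 2 ^ s :: nat}" by (simp add: card_image inj_on_subset)
    then show ?thesis by simp
  qed
  then show ?thesis using handshake by (simp add: mult.commute)
qed

text \<open>The colours are the elements of a coset of a subgroup, which is closed under sums of three
  elements. A rainbow broom uses all of them at its edges, so the sum of the three handle colours
  is the colour of a bristle, and that bristle ends at the end of the handle.\<close>

lemma rainbow_free_xor_graph:
  assumes t: "t = 2 ^ s" "3 \<le> t" and "m \<le> n"
  shows "rainbow_free (broom t 3) (xor_graph s m n)"
  unfolding rainbow_free_def
proof (intro exI[of _ xor_color] conjI allI impI notI)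
  show "proper_edge_coloring (xor_graph s m n) xor_color" by (rule proper_xor_color)
  fix H assume H: "is_subgraph H (xor_graph s m n) \<and> isomorphic (broom t 3) H"
    and rb: "rainbow xor_color H"
  let ?F = "broom t 3" and ?S = "{2 ^ s..<2 * 2 ^ s} :: nat set"
  obtain f where f: "bij_betw f (verts ?F) (verts H)"
    and iff: "\<forall>u\<in>verts ?F. \<forall>v\<in>verts ?F. {u, v} \<in> edges ?F \<longleftrightarrow> {f u, f v} \<in> edges H"
    using H unfolding isomorphic_def by blast
  have sub: "edges H \<subseteq> edges (xor_graph s m n)" and simple: "fin_simple_graph H"
    using H by (simp_all add: is_subgraph_def)
  have eH: "edges H = (`) f ` edges ?F"
    by (rule edges_eq_image_if_isomorphism[OF fin_simple_graph_broom[OF t(2)] simple f iff])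
  have inj: "inj_on f {0..t}" using f by (simp add: bij_betw_def broom_def)
  have "inj_on ((`) f) (edges ?F)"
    by (rule inj_on_subset[OF inj_on_image_Pow[OF inj]])
       (use t(2) in \<open>auto simp: edges_broom_3\<close>)
  then have "card (edges H) = t"
    using card_edges_broom[OF t(2)] by (simp add: eH card_image)
  then have card: "card (xor_color ` edges H) = t"
    using rb by (simp add: rainbow_def card_image)
  have color_S: "xor_color e \<in> ?S" if "e \<in> edges H" for e
  proof -
    obtain x y where "e = {x, y}" "drop_bit s (x XOR y) = 1"
      using \<open>e \<in> edges H\<close> sub unfolding xor_graph_def snd_conv by blast
    then show ?thesis unfolding drop_bit_eq_1_iff by simp
  qed
  have all: "xor_color ` edges H = ?S"
    by (rule card_subset_eq) (use card color_S t in auto)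
  have h: "{f 0, f 1} \<in> edges H" "{f 1, f 2} \<in> edges H" "{f 2, f 3} \<in> edges H"
    unfolding eH edges_broom_3 by (simp_all add: image_Un)
  let ?x = "f 0 XOR f 1" and ?y = "f 1 XOR f 2" and ?z = "f 2 XOR f 3"
  have "drop_bit s ?x = 1" "drop_bit s ?y = 1" "drop_bit s ?z = 1"
    using h[THEN color_S] unfolding drop_bit_eq_1_iff by simp_all
  \<comment> \<open>The sum along the handle telescopes, and bit \<open>s\<close> survives because
    three is odd.\<close>
  moreover have g: "f 3 XOR f 0 = ?x XOR ?y XOR ?z"
    by (simp only: xor.assoc xor_cancel xor.commute[of "f 3"])
  ultimately have "drop_bit s (f 3 XOR f 0) = 1"
    by (simp only: g drop_bit_xor) simp
  then have "f 3 XOR f 0 \<in> xor_color ` edges H" unfolding all drop_bit_eq_1_iff .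
  then obtain e where e: "e \<in> edges H" "f 3 XOR f 0 = xor_color e" by blast
  have ne: "f i \<noteq> f j" if "i \<le> t" "j \<le> t" "i \<noteq> j" for i j
    using inj_onD[OF inj] that by auto
  from e(1) have "e = {f 0, f 1} \<or> e = {f 1, f 2} \<or> e = {f 2, f 3} \<or> (\<exists>j\<in>{4..t}. e = {f 3, f j})"
    unfolding eH edges_broom_3 by (auto simp: image_Un)
  then show False
  proof (elim disjE bexE)
    assume "e = {f 0, f 1}"
    then have "f 3 = f 1" using e(2) by (metis xor.commute xor_cancel xor_color)
    then show False using ne[of 3 1] t(2) by simp
  next
    assume "e = {f 1, f 2}"
    \<comment> \<open>If the sum is the middle colour, the two outer handle edges have the same
      colour, against the rainbow property.\<close>
    then have "?x XOR ?y XOR ?z = ?y" using e(2) g by simp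
    then have "?x XOR ?z = 0" by (metis xor.assoc xor.commute xor_cancel xor_self_eq)
    then have "?x = ?z" by (metis xor.right_neutral xor_cancel)
    then have "xor_color {f 0, f 1} = xor_color {f 2, f 3}" by simp
    then have "{f 0, f 1} = {f 2, f 3}"
      using rb h(1,3) unfolding rainbow_def by (meson inj_onD)
    then show False using ne[of 0 2] ne[of 0 3] t(2) by (simp add: doubleton_eq_iff)
  next
    assume "e = {f 2, f 3}"
    then have "f 0 = f 2" using e(2) by (metis xor.commute xor_cancel xor_color)
    then show False using ne[of 0 2] t(2) by simp
  next
    fix j assume "j \<in> {4..t}" "e = {f 3, f j}"
    then have "f 0 = f j" using e(2) by (metis xor_cancel xor_color)
    then show False using ne[of 0 j] \<open>j \<in> {4..t}\<close> by simp
  qed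
qed

theorem theorem1p7:
  fixes s t :: nat
  assumes "s \<ge> 2" and "t = 2 ^ s"
  shows "(\<lambda>n::nat. real (rainbow_turan n (broom t 3)) - real t / 2 * real n) \<in> O(\<lambda>_. 1)"
proof (rule bigoI[where c = "real (t * t)"], rule always_eventually, rule allI)
  fix n :: nat
  let ?A = "{card (edges G) | G :: nat graph.
            fin_simple_graph G \<and> card (verts G) = n \<and> rainbow_free (broom t 3) G}"
  have t_dvd: "4 dvd t" using assms le_imp_power_dvd[of 2 s 2] by simp
  moreover have "t \<noteq> 0" using assms by simp
  ultimately have t: "4 \<le> t" by (auto dest: dvd_imp_le)
  have fin: "finite ?A" by (rule finite_rainbow_turan_set)
  have upper: "2 * rainbow_turan n (broom t 3) \<le> t * n"
  proof -
    have "?A \<noteq> {}"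
      by (rule rainbow_turan_set_nonempty[OF fin_simple_graph_broom])
        (use t in \<open>simp_all add: edges_broom_3\<close>)
    then have "rainbow_turan n (broom t 3) \<in> ?A"
      unfolding rainbow_turan_def using fin by (intro Max_in)
    then obtain G :: "nat graph" where "rainbow_turan n (broom t 3) = card (edges G)"
      "fin_simple_graph G" "card (verts G) = n" "rainbow_free (broom t 3) G" by blast
    then show ?thesis using rainbow_free_edge_bound[of G t] t t_dvd by simp
  qed
  \<comment> \<open>The largest multiple of the block size \<open>2t\<close> that is at most
    \<open>n\<close>.\<close>
  define m where "m = 2 * t * (n div (2 * t))"
  have m: "m \<le> n" "n \<le> m + 2 * t"
    using t mod_less_divisor[of "2 * t" n] mult_div_mod_eq[of "2 * t" n]
    unfolding m_def by linarith+
  let ?G = "xor_graph s m n"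
  have "card (edges ?G) \<in> ?A"
    using fin_simple_graph_xor_graph[OF m(1)] rainbow_free_xor_graph[OF assms(2) _ m(1)] t
    by (intro CollectI exI[of _ ?G]) (simp add: xor_graph_def)
  then have "card (edges ?G) \<le> rainbow_turan n (broom t 3)"
    unfolding rainbow_turan_def using fin by (intro Max_ge)
  moreover have "2 * card (edges ?G) = t * m"
    using card_edges_xor_graph[of m s "n div (2 * t)" n] m(1) assms(2) by (simp add: m_def)
  ultimately have "t * m \<le> 2 * rainbow_turan n (broom t 3)" by linarith
  \<comment> \<open>At most \<open>2t\<close> vertices lie outside the full blocks, each costing
    \<open>t / 2\<close> edges; this gives the constant \<open>t * t\<close>.\<close>
  moreover have "t * n \<le> t * m + 2 * (t * t)"
    using mult_le_mono2[OF m(2), of t] by (simp add: algebra_simps)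
  ultimately have "t * n \<le> 2 * rainbow_turan n (broom t 3) + 2 * (t * t)" by linarith
  then have "real (t * n) \<le> real (2 * rainbow_turan n (broom t 3) + 2 * (t * t))"
    by (rule of_nat_mono)
  moreover have "real (2 * rainbow_turan n (broom t 3)) \<le> real (t * n)"
    using upper by (rule of_nat_mono)
  ultimately show "norm (real (rainbow_turan n (broom t 3)) - real t / 2 * real n)
    \<le> real (t * t) * norm (1::real)"
    by simp
qed

end
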